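(* Let $i:Z\hookrightarrow X$ be a regular or normally oriented closed immersion of real codimension $2r$, with open complement $j:U\hookrightarrow X$ and oriented normal object $N\to Z$ with sphere bundle $\pi:S(N)\to Z$. Assume the purity, excision, orientation and Gysin hypotheses listed in the context, let $A\in\mathcal C(X)$, and let $c\in H^d(X;A)$ with $j^*c=0$. Then the secondary boundary group $$G_Z(c)=\mathrm{im}\bigl(\delta:H^{d-1}(U;j^*A)\to H_Z^d(X;A)\bigr)$$ of the torsor of supported refinements of $c$ corresponds, under the Thom isomorphism $\mathrm{Th}_i:H^{d-2r}(Z;i^*A)\xrightarrow{\sim}H_Z^d(X;A)$, to $$\mathrm{im}\bigl(\pi_*:H^{d-1}(S(N);\pi^*i^*A)\to H^{d-2r}(Z;i^*A)\bigr).$$ Equivalently, $$G_Z(c)\cong\ker\bigl(\cup e(N):H^{d-2r}(Z;i^*A)\to H^d(Z;i^*A)\bigr),$$ where $e(N)$ denotes the Euler class of the oriented normal object.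
   Context: Setting: each space $X$ has a stable triangulated symmetric monoidal category $\mathcal C(X)$ with unit $\mathbf 1_X$, and functors $f^*\dashv f_*$ with $f^*$ symmetric monoidal. For the closed immersion $i:Z\hookrightarrow X$ with open complement $j:U\hookrightarrow X$ the recollement axioms hold: $i^*\dashv i_*\dashv i^!$, $j_!\dashv j^*\dashv j_*$, $i_*,j_!$ fully faithful, $j^*i_*=0$, $i^*j_!=0$, and functorial distinguished triangles $j_!j^*M\to M\to i_*i^*M\xrightarrow{+1}$, $i_*i^!M\to M\to j_*j^*M\xrightarrow{+1}$. Put $H^d(X;A)=\mathrm{Hom}(\mathbf 1_X,A[d])$ and $H^d_Z(X;A)=\mathrm{Hom}(\mathbf 1_X,i_*i^!A[d])$. The localisation long exact sequence is $\cdots\to H_Z^d(X;A)\xrightarrow{\mathrm{forg}}H^d(X;A)\xrightarrow{j^*}H^d(U;j^*A)\xrightarrow{\delta}H_Z^{d+1}(X;A)\to\cdots$, obtained from the triangle $i_*i^!A\to A\to j_*j^*A\xrightarrow{+1}$. The set $\mathrm{Lift}_Z^d(c)=\{\widetilde c\in H_Z^d(X;A):\mathrm{forg}(\widetilde c)=c\}$ is a torsor under $\mathrm{im}\,\delta$. Standing hypotheses: (1) Excision / tubular neighbourhood: one may work in a tubular neighbourhood of $Z$ and replace the pair $(X,U)$ (and its localisation sequence) by the disk-bundle pair $(D(N),D(N)\setminus Z)$, where $D(N)\setminus Z$ retracts onto the sphere bundle $S(N)$. (2) Thom isomorphism: $\mathrm{Th}_i:H^{k-2r}(Z;i^*A)\xrightarrow{\sim}H_Z^k(X;A)$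 for all $k$. (3) Exact Gysin sequence of the oriented sphere bundle $\pi:S(N)\to Z$: $$\cdots\to H^{k-1}(S(N);\pi^*i^*A)\xrightarrow{\pi_*}H^{k-2r}(Z;i^*A)\xrightarrow{\cup e(N)}H^{k}(Z;i^*A)\xrightarrow{\pi^*}H^{k}(S(N);\pi^*i^*A)\to\cdots$$ where $\pi_*$ (transgression, Gysin boundary, fibre integration) lowers degree by $2r-1$. (4) After the excision (1) and the Thom identification (2), the localisation triangle of the pair $(D(N),D(N)\setminus Z)$ is identified with the Gysin triangle of $S(N)\to Z$. Thus $\mathrm{forg}$ corresponds to $\cup e(N)$, restriction to the open complement to $\pi^*$, and $\delta$ to $\pi_*$. *)

theory Defs
  imports "HOL-Algebra.Exact_Sequence"
begin

section \<open>Categories\<close>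

record ('o, 'm) cat =
  Ob :: "'o set"
  Ar :: "'m set"
  Dom :: "'m \<Rightarrow> 'o"
  Cod :: "'m \<Rightarrow> 'o"
  ident :: "'o \<Rightarrow> 'm"
  cmp :: "'m \<Rightarrow> 'm \<Rightarrow> 'm"  (infixr \<open>\<cdot>\<index>\<close> 75)

definition mor :: "('o, 'm, 'x) cat_scheme \<Rightarrow> 'o \<Rightarrow> 'o \<Rightarrow> 'm set" where
  "mor C a b = {f \<in> Ar C. Dom C f = a \<and> Cod C f = b}"

locale category =
  fixes C :: "('o, 'm, 'x) cat_scheme" (structure)
  assumes dom_ob: "f \<in> Ar C \<Longrightarrow> Dom C f \<in> Ob C"
    and cod_ob: "f \<in> Ar C \<Longrightarrow> Cod C f \<in> Ob C"
    and ident_mor: "a \<in> Ob C \<Longrightarrow> ident C a \<in> mor C a a"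
    and cmp_mor: "\<lbrakk>f \<in> mor C a b; g \<in> mor C b c\<rbrakk> \<Longrightarrow> g \<cdot> f \<in> mor C a c"
    and cmp_ident_left: "f \<in> mor C a b \<Longrightarrow> ident C b \<cdot> f = f"
    and cmp_ident_right: "f \<in> mor C a b \<Longrightarrow> f \<cdot> ident C a = f"
    and cmp_assoc: "\<lbrakk>f \<in> mor C a b; g \<in> mor C b c; h \<in> mor C c d\<rbrakk> \<Longrightarrow> (h \<cdot> g) \<cdot> f = h \<cdot> (g \<cdot> f)"

definition isos :: "('o, 'm, 'x) cat_scheme \<Rightarrow> 'o \<Rightarrow> 'o \<Rightarrow> 'm set" where
  "isos C a b = {f \<in> mor C a b. \<exists>g \<in> mor C b a. g \<cdot>\<^bsub>C\<^esub> f = ident C a \<and> f \<cdot>\<^bsub>C\<^esub> g = ident C b}"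

definition inv_ar :: "('o, 'm, 'x) cat_scheme \<Rightarrow> 'm \<Rightarrow> 'm" where
  "inv_ar C f = (THE g. g \<in> mor C (Cod C f) (Dom C f) \<and>
     g \<cdot>\<^bsub>C\<^esub> f = ident C (Dom C f) \<and> f \<cdot>\<^bsub>C\<^esub> g = ident C (Cod C f))"

record ('o, 'm) ftor =
  fo :: "'o \<Rightarrow> 'o"
  fm :: "'m \<Rightarrow> 'm"

definition is_functor ::
  "('o, 'm, 'x) cat_scheme \<Rightarrow> ('o, 'm, 'y) cat_scheme \<Rightarrow> ('o, 'm, 'z) ftor_scheme \<Rightarrow> bool" where
  "is_functor C D F \<longleftrightarrow>
     (\<forall>a \<in> Ob C. fo F a \<in> Ob D \<and> fm F (ident C a) = ident D (fo F a)) \<and>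
     (\<forall>a b. \<forall>f \<in> mor C a b. fm F f \<in> mor D (fo F a) (fo F b)) \<and>
     (\<forall>a b c. \<forall>f \<in> mor C a b. \<forall>g \<in> mor C b c. fm F (g \<cdot>\<^bsub>C\<^esub> f) = fm F g \<cdot>\<^bsub>D\<^esub> fm F f)"

definition fully_faithful ::
  "('o, 'm, 'x) cat_scheme \<Rightarrow> ('o, 'm, 'y) cat_scheme \<Rightarrow> ('o, 'm, 'z) ftor_scheme \<Rightarrow> bool" where
  "fully_faithful C D F \<longleftrightarrow>
     (\<forall>a \<in> Ob C. \<forall>b \<in> Ob C. bij_betw (fm F) (mor C a b) (mor D (fo F a) (fo F b)))"

definition nat_trans ::
  "('o, 'm, 'x) cat_scheme \<Rightarrow> ('o, 'm, 'y) cat_scheme \<Rightarrow> ('o, 'm, 'z) ftor_scheme \<Rightarrow>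
   ('o, 'm, 'w) ftor_scheme \<Rightarrow> ('o \<Rightarrow> 'm) \<Rightarrow> bool" where
  "nat_trans C D F G t \<longleftrightarrow>
     (\<forall>a \<in> Ob C. t a \<in> mor D (fo F a) (fo G a)) \<and>
     (\<forall>a b. \<forall>f \<in> mor C a b. t b \<cdot>\<^bsub>D\<^esub> fm F f = fm G f \<cdot>\<^bsub>D\<^esub> t a)"


section \<open>Triangulated categories\<close>

text \<open>The shift is a strict automorphism, recorded through all its powers: \<open>sh n a\<close> is \<open>a[n]\<close> and
  \<open>shm n f\<close> is \<open>f[n]\<close>. A distinguished triangle \<open>a \<rightarrow> b \<rightarrow> c \<rightarrow> a[1]\<close> is the triple of
  its three arrows.\<close>

record ('o, 'm) tricat = "('o, 'm) cat" +
  zero_ar :: "'o \<Rightarrow> 'o \<Rightarrow> 'm"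
  add_ar :: "'m \<Rightarrow> 'm \<Rightarrow> 'm"
  sh :: "int \<Rightarrow> 'o \<Rightarrow> 'o"
  shm :: "int \<Rightarrow> 'm \<Rightarrow> 'm"
  Tri :: "('m \<times> 'm \<times> 'm) set"

definition Hom_group :: "('o, 'm, 'x) tricat_scheme \<Rightarrow> 'o \<Rightarrow> 'o \<Rightarrow> 'm monoid" where
  "Hom_group C a b = \<lparr>carrier = mor C a b, mult = add_ar C, one = zero_ar C a b\<rparr>"

definition neg_ar :: "('o, 'm, 'x) tricat_scheme \<Rightarrow> 'm \<Rightarrow> 'm" where
  "neg_ar C f = inv\<^bsub>Hom_group C (Dom C f) (Cod C f)\<^esub> f"

definition zero_object :: "('o, 'm, 'x) tricat_scheme \<Rightarrow> 'o \<Rightarrow> bool" where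
  "zero_object C z \<longleftrightarrow> z \<in> Ob C \<and> ident C z = zero_ar C z z"

definition shift_ftor :: "('o, 'm, 'x) tricat_scheme \<Rightarrow> int \<Rightarrow> ('o, 'm) ftor" where
  "shift_ftor C n = \<lparr>fo = sh C n, fm = shm C n\<rparr>"

definition shifted :: "('o, 'm, 'x) tricat_scheme \<Rightarrow> ('o, 'm, 'z) ftor_scheme \<Rightarrow> ('o, 'm) ftor" where
    \<comment> \<open>\<open>a \<mapsto> (F a)[1]\<close>\<close>
  "shifted D F = \<lparr>fo = (\<lambda>a. sh D 1 (fo F a)), fm = (\<lambda>f. shm D 1 (fm F f))\<rparr>"

definition additive_functor ::
  "('o, 'm, 'x) tricat_scheme \<Rightarrow> ('o, 'm, 'y) tricat_scheme \<Rightarrow> ('o, 'm, 'z) ftor_scheme \<Rightarrow> bool" where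
  "additive_functor C D F \<longleftrightarrow> is_functor C D F \<and>
     (\<forall>a b. \<forall>f \<in> mor C a b. \<forall>g \<in> mor C a b. fm F (add_ar C f g) = add_ar D (fm F f) (fm F g))"

locale additive_category = category C
  for C :: "('o, 'm, 'x) tricat_scheme" (structure) +
  assumes Hom_comm_group: "\<lbrakk>a \<in> Ob C; b \<in> Ob C\<rbrakk> \<Longrightarrow> comm_group (Hom_group C a b)"
    and cmp_add_left: "\<lbrakk>f \<in> mor C a b; g \<in> mor C b c; h \<in> mor C b c\<rbrakk>
           \<Longrightarrow> add_ar C g h \<cdot> f = add_ar C (g \<cdot> f) (h \<cdot> f)"
    and cmp_add_right: "\<lbrakk>f \<in> mor C a b; g \<in> mor C a b; h \<in> mor C b c\<rbrakk>
           \<Longrightarrow> h \<cdot> add_ar C f g = add_ar C (h \<cdot> f) (h \<cdot> g)"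
    and zero_object_exists: "\<exists>z. zero_object C z"
    and biproduct_exists: "\<lbrakk>a \<in> Ob C; b \<in> Ob C\<rbrakk> \<Longrightarrow>
           \<exists>s. \<exists>i1 \<in> mor C a s. \<exists>i2 \<in> mor C b s. \<exists>p1 \<in> mor C s a. \<exists>p2 \<in> mor C s b.
             p1 \<cdot> i1 = ident C a \<and> p2 \<cdot> i2 = ident C b \<and>
             p2 \<cdot> i1 = zero_ar C a b \<and> p1 \<cdot> i2 = zero_ar C b a \<and>
             add_ar C (i1 \<cdot> p1) (i2 \<cdot> p2) = ident C s"

locale triangulated_category = additive_category C
  for C :: "('o, 'm, 'x) tricat_scheme" (structure) +
  assumes shift_additive: "additive_functor C C (shift_ftor C n)"
    and shift_0: "a \<in> Ob C \<Longrightarrow> sh C 0 a = a"  "f \<in> Ar C \<Longrightarrow> shm C 0 f = f"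
    and shift_add: "a \<in> Ob C \<Longrightarrow> sh C (m + n) a = sh C m (sh C n a)"
                   "f \<in> Ar C \<Longrightarrow> shm C (m + n) f = shm C m (shm C n f)"
    and Tri_mor: "(f, g, h) \<in> Tri C \<Longrightarrow>
           \<exists>a b c. f \<in> mor C a b \<and> g \<in> mor C b c \<and> h \<in> mor C c (sh C 1 a)"
    and Tri_iso: "\<lbrakk>(f, g, h) \<in> Tri C;
            f \<in> mor C a b; g \<in> mor C b c; h \<in> mor C c (sh C 1 a);
            f' \<in> mor C a' b'; g' \<in> mor C b' c'; h' \<in> mor C c' (sh C 1 a');
            u \<in> isos C a a'; v \<in> isos C b b'; w \<in> isos C c c';
            v \<cdot> f = f' \<cdot> u; w \<cdot> g = g' \<cdot> v; shm C 1 u \<cdot> h = h' \<cdot> w\<rbrakk>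
           \<Longrightarrow> (f', g', h') \<in> Tri C"
    and Tri_ident: "\<lbrakk>a \<in> Ob C; zero_object C z\<rbrakk>
           \<Longrightarrow> (ident C a, zero_ar C a z, zero_ar C z (sh C 1 a)) \<in> Tri C"
    and Tri_cone: "f \<in> Ar C \<Longrightarrow> \<exists>g h. (f, g, h) \<in> Tri C"
    and Tri_rotate: "\<lbrakk>f \<in> mor C a b; g \<in> mor C b c; h \<in> mor C c (sh C 1 a)\<rbrakk>
           \<Longrightarrow> (f, g, h) \<in> Tri C \<longleftrightarrow> (g, h, neg_ar C (shm C 1 f)) \<in> Tri C"
    and Tri_morphism: "\<lbrakk>(f, g, h) \<in> Tri C; (f', g', h') \<in> Tri C;
            u \<in> mor C (Dom C f) (Dom C f'); v \<in> mor C (Cod C f) (Cod C f'); v \<cdot> f = f' \<cdot> u\<rbrakk>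
           \<Longrightarrow> \<exists>w \<in> mor C (Cod C g) (Cod C g'). w \<cdot> g = g' \<cdot> v \<and> shm C 1 u \<cdot> h = h' \<cdot> w"
    and Tri_octahedron: "\<lbrakk>f \<in> mor C a b; g \<in> mor C b c;
            (f, f1, f2) \<in> Tri C; (g, g1, g2) \<in> Tri C; (g \<cdot> f, h1, h2) \<in> Tri C\<rbrakk>
           \<Longrightarrow> \<exists>u \<in> mor C (Cod C f1) (Cod C h1). \<exists>v \<in> mor C (Cod C h1) (Cod C g1).
             (u, v, shm C 1 f1 \<cdot> g2) \<in> Tri C \<and> u \<cdot> f1 = h1 \<cdot> g \<and> v \<cdot> h1 = g1 \<and>
             h2 \<cdot> u = f2 \<and> g2 \<cdot> v = shm C 1 f \<cdot> h2"


subsection \<open>Exact functors and exact adjunctions\<close>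

text \<open>An exact functor carries its comparison isomorphisms \<open>fsh n a : F(a[n]) \<rightarrow> (F a)[n]\<close>.\<close>

record ('o, 'm) xftor = "('o, 'm) ftor" +
  fsh :: "int \<Rightarrow> 'o \<Rightarrow> 'm"

definition exact_functor ::
  "('o, 'm, 'x) tricat_scheme \<Rightarrow> ('o, 'm, 'y) tricat_scheme \<Rightarrow> ('o, 'm, 'z) xftor_scheme \<Rightarrow> bool" where
  "exact_functor C D F \<longleftrightarrow> additive_functor C D F \<and>
     (\<forall>n. \<forall>a \<in> Ob C. fsh F n a \<in> isos D (fo F (sh C n a)) (sh D n (fo F a))) \<and>
     (\<forall>n a b. \<forall>f \<in> mor C a b. fsh F n b \<cdot>\<^bsub>D\<^esub> fm F (shm C n f) = shm D n (fm F f) \<cdot>\<^bsub>D\<^esub> fsh F n a) \<and>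
     (\<forall>a \<in> Ob C. fsh F 0 a = ident D (fo F a)) \<and>
     (\<forall>m n. \<forall>a \<in> Ob C. fsh F (m + n) a = shm D m (fsh F n a) \<cdot>\<^bsub>D\<^esub> fsh F m (sh C n a)) \<and>
     (\<forall>f g h. (f, g, h) \<in> Tri C \<longrightarrow> (fm F f, fm F g, fsh F 1 (Dom C f) \<cdot>\<^bsub>D\<^esub> fm F h) \<in> Tri D)"

definition id_xftor :: "('o, 'm, 'x) tricat_scheme \<Rightarrow> ('o, 'm) xftor" where
  "id_xftor C = \<lparr>fo = (\<lambda>a. a), fm = (\<lambda>f. f), fsh = (\<lambda>n a. ident C (sh C n a))\<rparr>"

definition comp_xftor :: \<comment> \<open>\<open>G\<close> after \<open>F\<close>; the first argument is the target category of \<open>G\<close>\<close>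
  "('o, 'm, 'x) tricat_scheme \<Rightarrow> ('o, 'm) xftor \<Rightarrow> ('o, 'm) xftor \<Rightarrow> ('o, 'm) xftor" where
  "comp_xftor E G F = \<lparr>fo = (\<lambda>a. fo G (fo F a)), fm = (\<lambda>f. fm G (fm F f)),
     fsh = (\<lambda>n a. fsh G n (fo F a) \<cdot>\<^bsub>E\<^esub> fm G (fsh F n a))\<rparr>"

definition exact_nat_trans ::
  "('o, 'm, 'x) tricat_scheme \<Rightarrow> ('o, 'm, 'y) tricat_scheme \<Rightarrow> ('o, 'm) xftor \<Rightarrow> ('o, 'm) xftor \<Rightarrow>
   ('o \<Rightarrow> 'm) \<Rightarrow> bool" where
  "exact_nat_trans C D F G t \<longleftrightarrow> nat_trans C D F G t \<and>
     (\<forall>n. \<forall>a \<in> Ob C. fsh G n a \<cdot>\<^bsub>D\<^esub> t (sh C n a) = shm D n (t a) \<cdot>\<^bsub>D\<^esub> fsh F n a)"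

definition exact_adjunction :: \<comment> \<open>\<open>F : C \<rightarrow> D\<close> is left adjoint to \<open>G : D \<rightarrow> C\<close>, with unit \<open>\<eta>\<close> and counit \<open>\<epsilon>\<close>\<close>
  "('o, 'm, 'x) tricat_scheme \<Rightarrow> ('o, 'm, 'y) tricat_scheme \<Rightarrow> ('o, 'm) xftor \<Rightarrow> ('o, 'm) xftor \<Rightarrow>
   ('o \<Rightarrow> 'm) \<Rightarrow> ('o \<Rightarrow> 'm) \<Rightarrow> bool" where
  "exact_adjunction C D F G \<eta> \<epsilon> \<longleftrightarrow>
     exact_functor C D F \<and> exact_functor D C G \<and>
     exact_nat_trans C C (id_xftor C) (comp_xftor C G F) \<eta> \<and>
     exact_nat_trans D D (comp_xftor D F G) (id_xftor D) \<epsilon> \<and>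
     (\<forall>a \<in> Ob C. \<epsilon> (fo F a) \<cdot>\<^bsub>D\<^esub> fm F (\<eta> a) = ident D (fo F a)) \<and>
     (\<forall>b \<in> Ob D. fm G (\<epsilon> b) \<cdot>\<^bsub>C\<^esub> \<eta> (fo G b) = ident C (fo G b))"


section \<open>Tensor triangulated categories\<close>

text \<open>\<open>assc a b c : (a \<otimes> b) \<otimes> c \<rightarrow> a \<otimes> (b \<otimes> c)\<close>, \<open>lun a : \<one> \<otimes> a \<rightarrow> a\<close>, \<open>run a : a \<otimes> \<one> \<rightarrow> a\<close>,
  \<open>brd a b : a \<otimes> b \<rightarrow> b \<otimes> a\<close>, \<open>rsh n a b : a \<otimes> b[n] \<rightarrow> (a \<otimes> b)[n]\<close>.\<close>

record ('o, 'm) ttcat = "('o, 'm) tricat" +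
  unit_ob :: "'o"
  ten :: "'o \<Rightarrow> 'o \<Rightarrow> 'o"
  tenm :: "'m \<Rightarrow> 'm \<Rightarrow> 'm"
  assc :: "'o \<Rightarrow> 'o \<Rightarrow> 'o \<Rightarrow> 'm"
  lun :: "'o \<Rightarrow> 'm"
  run :: "'o \<Rightarrow> 'm"
  brd :: "'o \<Rightarrow> 'o \<Rightarrow> 'm"
  rsh :: "int \<Rightarrow> 'o \<Rightarrow> 'o \<Rightarrow> 'm"

definition ten_ftor :: "('o, 'm, 'x) ttcat_scheme \<Rightarrow> 'o \<Rightarrow> ('o, 'm) xftor" where
  "ten_ftor C a = \<lparr>fo = ten C a, fm = tenm C (ident C a), fsh = (\<lambda>n. rsh C n a)\<rparr>"

definition lsh :: "('o, 'm, 'x) ttcat_scheme \<Rightarrow> int \<Rightarrow> 'o \<Rightarrow> 'o \<Rightarrow> 'm" where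
    \<comment> \<open>\<open>lsh n a b : a[n] \<otimes> b \<rightarrow> (a \<otimes> b)[n]\<close>\<close>
  "lsh C n a b = shm C n (brd C b a) \<cdot>\<^bsub>C\<^esub> rsh C n b a \<cdot>\<^bsub>C\<^esub> brd C (sh C n a) b"

locale tt_category = triangulated_category C
  for C :: "('o, 'm, 'x) ttcat_scheme" (structure) +
  assumes unit_ob: "unit_ob C \<in> Ob C"
    and tenm_mor: "\<lbrakk>f \<in> mor C a b; g \<in> mor C a' b'\<rbrakk> \<Longrightarrow> tenm C f g \<in> mor C (ten C a a') (ten C b b')"
    and tenm_cmp: "\<lbrakk>f \<in> mor C a b; g \<in> mor C b c; f' \<in> mor C a' b'; g' \<in> mor C b' c'\<rbrakk>
           \<Longrightarrow> tenm C (g \<cdot> f) (g' \<cdot> f') = tenm C g g' \<cdot> tenm C f f'"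
    and ten_exact: "a \<in> Ob C \<Longrightarrow> exact_functor C C (ten_ftor C a)"
    and assc_iso: "\<lbrakk>a \<in> Ob C; b \<in> Ob C; c \<in> Ob C\<rbrakk>
           \<Longrightarrow> assc C a b c \<in> isos C (ten C (ten C a b) c) (ten C a (ten C b c))"
    and assc_nat: "\<lbrakk>f \<in> mor C a a'; g \<in> mor C b b'; h \<in> mor C c c'\<rbrakk>
           \<Longrightarrow> assc C a' b' c' \<cdot> tenm C (tenm C f g) h = tenm C f (tenm C g h) \<cdot> assc C a b c"
    and lun_iso: "a \<in> Ob C \<Longrightarrow> lun C a \<in> isos C (ten C (unit_ob C) a) a"
    and lun_nat: "f \<in> mor C a b \<Longrightarrow> lun C b \<cdot> tenm C (ident C (unit_ob C)) f = f \<cdot> lun C a"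
    and run_iso: "a \<in> Ob C \<Longrightarrow> run C a \<in> isos C (ten C a (unit_ob C)) a"
    and run_nat: "f \<in> mor C a b \<Longrightarrow> run C b \<cdot> tenm C f (ident C (unit_ob C)) = f \<cdot> run C a"
    and brd_mor: "\<lbrakk>a \<in> Ob C; b \<in> Ob C\<rbrakk> \<Longrightarrow> brd C a b \<in> mor C (ten C a b) (ten C b a)"
    and brd_nat: "\<lbrakk>f \<in> mor C a a'; g \<in> mor C b b'\<rbrakk>
           \<Longrightarrow> brd C a' b' \<cdot> tenm C f g = tenm C g f \<cdot> brd C a b"
    and brd_sym: "\<lbrakk>a \<in> Ob C; b \<in> Ob C\<rbrakk> \<Longrightarrow> brd C b a \<cdot> brd C a b = ident C (ten C a b)"
    and triangle: "\<lbrakk>a \<in> Ob C; b \<in> Ob C\<rbrakk>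
           \<Longrightarrow> tenm C (ident C a) (lun C b) \<cdot> assc C a (unit_ob C) b = tenm C (run C a) (ident C b)"
    and pentagon: "\<lbrakk>a \<in> Ob C; b \<in> Ob C; c \<in> Ob C; d \<in> Ob C\<rbrakk>
           \<Longrightarrow> tenm C (ident C a) (assc C b c d) \<cdot> assc C a (ten C b c) d \<cdot> tenm C (assc C a b c) (ident C d)
             = assc C a b (ten C c d) \<cdot> assc C (ten C a b) c d"
    and hexagon: "\<lbrakk>a \<in> Ob C; b \<in> Ob C; c \<in> Ob C\<rbrakk>
           \<Longrightarrow> assc C b c a \<cdot> brd C a (ten C b c) \<cdot> assc C a b c
             = tenm C (ident C b) (brd C a c) \<cdot> assc C b a c \<cdot> tenm C (brd C a b) (ident C c)"
    and rsh_nat_left: "\<lbrakk>f \<in> mor C a a'; b \<in> Ob C\<rbrakk>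
           \<Longrightarrow> rsh C n a' b \<cdot> tenm C f (ident C (sh C n b)) = shm C n (tenm C f (ident C b)) \<cdot> rsh C n a b"
    and rsh_lun: "a \<in> Ob C \<Longrightarrow> shm C n (lun C a) \<cdot> rsh C n (unit_ob C) a = lun C (sh C n a)"
    and rsh_assc: "\<lbrakk>a \<in> Ob C; b \<in> Ob C; c \<in> Ob C\<rbrakk>
           \<Longrightarrow> shm C n (assc C a b c) \<cdot> rsh C n (ten C a b) c
             = rsh C n a (ten C b c) \<cdot> tenm C (ident C a) (rsh C n b c) \<cdot> assc C a b (sh C n c)"
    and rsh_lsh_anticommute: "\<lbrakk>a \<in> Ob C; b \<in> Ob C\<rbrakk>
           \<Longrightarrow> shm C 1 (lsh C 1 a b) \<cdot> rsh C 1 (sh C 1 a) b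
             = neg_ar C (shm C 1 (rsh C 1 a b) \<cdot> lsh C 1 a (sh C 1 b))"


section \<open>Coefficient systems over a category of spaces\<close>

text \<open>For \<open>f : Y \<rightarrow> X\<close>: \<open>pul f = f\<^sup>*\<close>, \<open>psh f = f\<^sub>*\<close>, with adjunction unit \<open>eta f\<close> and counit \<open>eps f\<close>,
  monoidal structure \<open>pten f a b : f\<^sup>*a \<otimes> f\<^sup>*b \<rightarrow> f\<^sup>*(a \<otimes> b)\<close> and \<open>pun f : \<one> \<rightarrow> f\<^sup>*\<one>\<close>, and coherence
  isomorphisms \<open>pcmp g f a : (g \<cdot> f)\<^sup>*a \<rightarrow> f\<^sup>*g\<^sup>*a\<close> and \<open>pid X a : (id\<^sub>X)\<^sup>*a \<rightarrow> a\<close>. All categories share the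
  types of objects and arrows; this is no restriction, as the sets of objects and arrows vary.\<close>

record ('s, 'f, 'o, 'm) coef_system =
  Sp :: "('s, 'f) cat"
  cc :: "'s \<Rightarrow> ('o, 'm) ttcat"
  pul :: "'f \<Rightarrow> ('o, 'm) xftor"
  psh :: "'f \<Rightarrow> ('o, 'm) xftor"
  eta :: "'f \<Rightarrow> 'o \<Rightarrow> 'm"
  eps :: "'f \<Rightarrow> 'o \<Rightarrow> 'm"
  pten :: "'f \<Rightarrow> 'o \<Rightarrow> 'o \<Rightarrow> 'm"
  pun :: "'f \<Rightarrow> 'm"
  pcmp :: "'f \<Rightarrow> 'f \<Rightarrow> 'o \<Rightarrow> 'm"
  pid :: "'s \<Rightarrow> 'o \<Rightarrow> 'm"

abbreviation src :: "('s, 'f, 'o, 'm) coef_system \<Rightarrow> 'f \<Rightarrow> ('o, 'm) ttcat" where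
  "src S f \<equiv> cc S (Dom (Sp S) f)"

abbreviation tgt :: "('s, 'f, 'o, 'm) coef_system \<Rightarrow> 'f \<Rightarrow> ('o, 'm) ttcat" where
  "tgt S f \<equiv> cc S (Cod (Sp S) f)"

definition symmetric_monoidal ::
  "('o, 'm) ttcat \<Rightarrow> ('o, 'm) ttcat \<Rightarrow> ('o, 'm) xftor \<Rightarrow> ('o \<Rightarrow> 'o \<Rightarrow> 'm) \<Rightarrow> 'm \<Rightarrow> bool" where
  "symmetric_monoidal C D F t u \<longleftrightarrow>
     u \<in> isos D (unit_ob D) (fo F (unit_ob C)) \<and>
     (\<forall>a \<in> Ob C. \<forall>b \<in> Ob C. t a b \<in> isos D (ten D (fo F a) (fo F b)) (fo F (ten C a b))) \<and>
     (\<forall>a a' b b'. \<forall>f \<in> mor C a a'. \<forall>g \<in> mor C b b'.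
        t a' b' \<cdot>\<^bsub>D\<^esub> tenm D (fm F f) (fm F g) = fm F (tenm C f g) \<cdot>\<^bsub>D\<^esub> t a b) \<and>
     (\<forall>a \<in> Ob C. \<forall>b \<in> Ob C. \<forall>c \<in> Ob C.
        fm F (assc C a b c) \<cdot>\<^bsub>D\<^esub> t (ten C a b) c \<cdot>\<^bsub>D\<^esub> tenm D (t a b) (ident D (fo F c))
        = t a (ten C b c) \<cdot>\<^bsub>D\<^esub> tenm D (ident D (fo F a)) (t b c) \<cdot>\<^bsub>D\<^esub> assc D (fo F a) (fo F b) (fo F c)) \<and>
     (\<forall>a \<in> Ob C. fm F (lun C a) \<cdot>\<^bsub>D\<^esub> t (unit_ob C) a \<cdot>\<^bsub>D\<^esub> tenm D u (ident D (fo F a)) = lun D (fo F a)) \<and>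
     (\<forall>a \<in> Ob C. fm F (run C a) \<cdot>\<^bsub>D\<^esub> t a (unit_ob C) \<cdot>\<^bsub>D\<^esub> tenm D (ident D (fo F a)) u = run D (fo F a)) \<and>
     (\<forall>a \<in> Ob C. \<forall>b \<in> Ob C. fm F (brd C a b) \<cdot>\<^bsub>D\<^esub> t a b = t b a \<cdot>\<^bsub>D\<^esub> brd D (fo F a) (fo F b)) \<and>
     (\<forall>n. \<forall>a \<in> Ob C. \<forall>b \<in> Ob C.
        fsh F n (ten C a b) \<cdot>\<^bsub>D\<^esub> fm F (rsh C n a b) \<cdot>\<^bsub>D\<^esub> t a (sh C n b)
        = shm D n (t a b) \<cdot>\<^bsub>D\<^esub> rsh D n (fo F a) (fo F b) \<cdot>\<^bsub>D\<^esub> tenm D (ident D (fo F a)) (fsh F n b))"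

locale coefficient_system =
  fixes S :: "('s, 'f, 'o, 'm) coef_system"
  assumes spaces: "category (Sp S)"
    and coefficients: "X \<in> Ob (Sp S) \<Longrightarrow> tt_category (cc S X)"
    and pul_psh: "f \<in> Ar (Sp S) \<Longrightarrow>
           exact_adjunction (tgt S f) (src S f) (pul S f) (psh S f) (eta S f) (eps S f)"
    and pul_monoidal: "f \<in> Ar (Sp S) \<Longrightarrow>
           symmetric_monoidal (tgt S f) (src S f) (pul S f) (pten S f) (pun S f)"
    and pcmp_iso: "\<lbrakk>f \<in> mor (Sp S) W Y; g \<in> mor (Sp S) Y X; a \<in> Ob (cc S X)\<rbrakk>
           \<Longrightarrow> pcmp S g f a \<in> isos (cc S W) (fo (pul S (g \<cdot>\<^bsub>Sp S\<^esub> f)) a) (fo (pul S f) (fo (pul S g) a))"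
    and pcmp_nat: "\<lbrakk>f \<in> mor (Sp S) W Y; g \<in> mor (Sp S) Y X\<rbrakk>
           \<Longrightarrow> exact_nat_trans (cc S X) (cc S W) (pul S (g \<cdot>\<^bsub>Sp S\<^esub> f))
                 (comp_xftor (cc S W) (pul S f) (pul S g)) (pcmp S g f)"
    and pcmp_pun: "\<lbrakk>f \<in> mor (Sp S) W Y; g \<in> mor (Sp S) Y X\<rbrakk>
           \<Longrightarrow> pcmp S g f (unit_ob (cc S X)) \<cdot>\<^bsub>cc S W\<^esub> pun S (g \<cdot>\<^bsub>Sp S\<^esub> f)
             = fm (pul S f) (pun S g) \<cdot>\<^bsub>cc S W\<^esub> pun S f"
    and pcmp_pten: "\<lbrakk>f \<in> mor (Sp S) W Y; g \<in> mor (Sp S) Y X; a \<in> Ob (cc S X); b \<in> Ob (cc S X)\<rbrakk>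
           \<Longrightarrow> pcmp S g f (ten (cc S X) a b) \<cdot>\<^bsub>cc S W\<^esub> pten S (g \<cdot>\<^bsub>Sp S\<^esub> f) a b
             = fm (pul S f) (pten S g a b) \<cdot>\<^bsub>cc S W\<^esub> pten S f (fo (pul S g) a) (fo (pul S g) b)
                 \<cdot>\<^bsub>cc S W\<^esub> tenm (cc S W) (pcmp S g f a) (pcmp S g f b)"
    and pcmp_assoc: "\<lbrakk>f \<in> mor (Sp S) V W; g \<in> mor (Sp S) W Y; h \<in> mor (Sp S) Y X; a \<in> Ob (cc S X)\<rbrakk>
           \<Longrightarrow> fm (pul S f) (pcmp S h g a) \<cdot>\<^bsub>cc S V\<^esub> pcmp S (h \<cdot>\<^bsub>Sp S\<^esub> g) f a
             = pcmp S g f (fo (pul S h) a) \<cdot>\<^bsub>cc S V\<^esub> pcmp S h (g \<cdot>\<^bsub>Sp S\<^esub> f) a"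
    and pid_iso: "\<lbrakk>X \<in> Ob (Sp S); a \<in> Ob (cc S X)\<rbrakk>
           \<Longrightarrow> pid S X a \<in> isos (cc S X) (fo (pul S (ident (Sp S) X)) a) a"
    and pid_nat: "X \<in> Ob (Sp S) \<Longrightarrow>
           exact_nat_trans (cc S X) (cc S X) (pul S (ident (Sp S) X)) (id_xftor (cc S X)) (pid S X)"
    and pid_pun: "X \<in> Ob (Sp S) \<Longrightarrow>
           pid S X (unit_ob (cc S X)) \<cdot>\<^bsub>cc S X\<^esub> pun S (ident (Sp S) X) = ident (cc S X) (unit_ob (cc S X))"
    and pid_pten: "\<lbrakk>X \<in> Ob (Sp S); a \<in> Ob (cc S X); b \<in> Ob (cc S X)\<rbrakk>
           \<Longrightarrow> pid S X (ten (cc S X) a b) \<cdot>\<^bsub>cc S X\<^esub> pten S (ident (Sp S) X) a b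
             = tenm (cc S X) (pid S X a) (pid S X b)"
    and pcmp_ident_right: "\<lbrakk>f \<in> mor (Sp S) Y X; a \<in> Ob (cc S X)\<rbrakk>
           \<Longrightarrow> pid S Y (fo (pul S f) a) \<cdot>\<^bsub>cc S Y\<^esub> pcmp S f (ident (Sp S) Y) a = ident (cc S Y) (fo (pul S f) a)"
    and pcmp_ident_left: "\<lbrakk>f \<in> mor (Sp S) Y X; a \<in> Ob (cc S X)\<rbrakk>
           \<Longrightarrow> fm (pul S f) (pid S X a) \<cdot>\<^bsub>cc S Y\<^esub> pcmp S (ident (Sp S) X) f a = ident (cc S Y) (fo (pul S f) a)"


section \<open>Recollement\<close>

text \<open>The functors \<open>ups = i\<^sup>!\<close> and \<open>low = j\<^sub>!\<close>, the units and counits of \<open>i\<^sub>* \<stileturn> i\<^sup>!\<close> and \<open>j\<^sub>! \<stileturn> j\<^sup>*\<close>, and the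
  connecting maps \<open>bdl a : i\<^sub>*i\<^sup>*a \<rightarrow> (j\<^sub>!j\<^sup>*a)[1]\<close> and \<open>bdr a : j\<^sub>*j\<^sup>*a \<rightarrow> (i\<^sub>*i\<^sup>!a)[1]\<close> of the two
  localisation triangles.\<close>

record ('o, 'm) recol =
  ups :: "('o, 'm) xftor"
  eta_ups :: "'o \<Rightarrow> 'm"
  eps_ups :: "'o \<Rightarrow> 'm"
  low :: "('o, 'm) xftor"
  eta_low :: "'o \<Rightarrow> 'm"
  eps_low :: "'o \<Rightarrow> 'm"
  bdl :: "'o \<Rightarrow> 'm"
  bdr :: "'o \<Rightarrow> 'm"

definition recollement ::
  "('s, 'f, 'o, 'm) coef_system \<Rightarrow> 'f \<Rightarrow> 'f \<Rightarrow> ('o, 'm) recol \<Rightarrow> bool" where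
  "recollement S i j R \<longleftrightarrow>
     i \<in> Ar (Sp S) \<and> j \<in> Ar (Sp S) \<and> Cod (Sp S) i = Cod (Sp S) j \<and>
     exact_adjunction (src S i) (tgt S i) (psh S i) (ups R) (eta_ups R) (eps_ups R) \<and>
     exact_adjunction (src S j) (tgt S j) (low R) (pul S j) (eta_low R) (eps_low R) \<and>
     fully_faithful (src S i) (tgt S i) (psh S i) \<and>
     fully_faithful (src S j) (tgt S j) (low R) \<and>
     (\<forall>b \<in> Ob (src S i). zero_object (src S j) (fo (pul S j) (fo (psh S i) b))) \<and>
     (\<forall>b \<in> Ob (src S j). zero_object (src S i) (fo (pul S i) (fo (low R) b))) \<and>
     nat_trans (tgt S i) (tgt S i) (comp_xftor (tgt S i) (psh S i) (pul S i))
       (shifted (tgt S i) (comp_xftor (tgt S i) (low R) (pul S j))) (bdl R) \<and>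
     nat_trans (tgt S i) (tgt S i) (comp_xftor (tgt S i) (psh S j) (pul S j))
       (shifted (tgt S i) (comp_xftor (tgt S i) (psh S i) (ups R))) (bdr R) \<and>
     (\<forall>a \<in> Ob (tgt S i). (eps_low R a, eta S i a, bdl R a) \<in> Tri (tgt S i)) \<and>
     (\<forall>a \<in> Ob (tgt S i). (eps_ups R a, eta S j a, bdr R a) \<in> Tri (tgt S i))"


section \<open>Cohomology and the localisation sequence\<close>

definition coh :: "('s, 'f, 'o, 'm) coef_system \<Rightarrow> 's \<Rightarrow> 'o \<Rightarrow> int \<Rightarrow> 'm monoid" where
  "coh S X A k = Hom_group (cc S X) (unit_ob (cc S X)) (sh (cc S X) k A)"

abbreviation supp_obj :: "('s, 'f, 'o, 'm) coef_system \<Rightarrow> 'f \<Rightarrow> ('o, 'm) recol \<Rightarrow> 'o \<Rightarrow> 'o" where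
  "supp_obj S i R A \<equiv> fo (psh S i) (fo (ups R) A)"  \<comment> \<open>\<open>i\<^sub>*i\<^sup>!A\<close>\<close>

definition coh_supp ::
  "('s, 'f, 'o, 'm) coef_system \<Rightarrow> 'f \<Rightarrow> ('o, 'm) recol \<Rightarrow> 'o \<Rightarrow> int \<Rightarrow> 'm monoid" where
  "coh_supp S i R A k = coh S (Cod (Sp S) i) (supp_obj S i R A) k"

definition res :: "('s, 'f, 'o, 'm) coef_system \<Rightarrow> 'f \<Rightarrow> 'o \<Rightarrow> int \<Rightarrow> 'm \<Rightarrow> 'm" where
    \<comment> \<open>\<open>f\<^sup>* : H\<^sup>k(X;A) \<rightarrow> H\<^sup>k(Y;f\<^sup>*A)\<close>\<close>
  "res S f A k x = fsh (pul S f) k A \<cdot>\<^bsub>src S f\<^esub> fm (pul S f) x \<cdot>\<^bsub>src S f\<^esub> pun S f"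

definition transp :: "('s, 'f, 'o, 'm) coef_system \<Rightarrow> 'f \<Rightarrow> 'o \<Rightarrow> int \<Rightarrow> 'm \<Rightarrow> 'm" where
    \<comment> \<open>the adjunction isomorphism \<open>H\<^sup>k(Y;B) \<rightarrow> H\<^sup>k(X;f\<^sub>*B)\<close>\<close>
  "transp S f B k x = fsh (psh S f) k B \<cdot>\<^bsub>tgt S f\<^esub>
     fm (psh S f) (x \<cdot>\<^bsub>src S f\<^esub> inv_ar (src S f) (pun S f)) \<cdot>\<^bsub>tgt S f\<^esub> eta S f (unit_ob (tgt S f))"

definition forg :: "('s, 'f, 'o, 'm) coef_system \<Rightarrow> 'f \<Rightarrow> ('o, 'm) recol \<Rightarrow> 'o \<Rightarrow> int \<Rightarrow> 'm \<Rightarrow> 'm" where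
  "forg S i R A k x = shm (tgt S i) k (eps_ups R A) \<cdot>\<^bsub>tgt S i\<^esub> x"

definition delta :: "('s, 'f, 'o, 'm) coef_system \<Rightarrow> 'f \<Rightarrow> ('o, 'm) recol \<Rightarrow> 'o \<Rightarrow> int \<Rightarrow> 'm \<Rightarrow> 'm" where
    \<comment> \<open>\<open>\<delta> : H\<^sup>k(U;j\<^sup>*A) \<rightarrow> H\<^sub>Z\<^sup>k\<^sup>+\<^sup>1(X;A)\<close>\<close>
  "delta S j R A k x = shm (tgt S j) k (bdr R A) \<cdot>\<^bsub>tgt S j\<^esub> transp S j (fo (pul S j) A) k x"

text \<open>The group \<open>G\<^sub>Z(c)\<close> acting by translation on the torsor of all \<open>c'\<close> in \<open>H\<^sub>Z\<^sup>d(X;A)\<close> with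
  \<open>forg c' = c\<close>. The torsor depends on \<open>c\<close>, the group does not.\<close>

definition secondary_boundary_group ::
  "('s, 'f, 'o, 'm) coef_system \<Rightarrow> 'f \<Rightarrow> 'f \<Rightarrow> ('o, 'm) recol \<Rightarrow> 'o \<Rightarrow> int \<Rightarrow> 'm \<Rightarrow> 'm set" where
  "secondary_boundary_group S i j R A d c =
     delta S j R A (d - 1) ` carrier (coh S (Dom (Sp S) j) (fo (pul S j) A) (d - 1))"

definition cup :: "('o, 'm) ttcat \<Rightarrow> 'o \<Rightarrow> 'o \<Rightarrow> int \<Rightarrow> int \<Rightarrow> 'm \<Rightarrow> 'm \<Rightarrow> 'm" where
    \<comment> \<open>\<open>H\<^sup>m(X;A) \<times> H\<^sup>n(X;B) \<rightarrow> H\<^sup>m\<^sup>+\<^sup>n(X;A \<otimes> B)\<close>\<close>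
  "cup C A B m n x y = shm C n (lsh C m A B) \<cdot>\<^bsub>C\<^esub> rsh C n (sh C m A) B \<cdot>\<^bsub>C\<^esub> tenm C x y
     \<cdot>\<^bsub>C\<^esub> inv_ar C (lun C (unit_ob C))"

definition cup_unit :: "('o, 'm) ttcat \<Rightarrow> 'o \<Rightarrow> int \<Rightarrow> int \<Rightarrow> 'm \<Rightarrow> 'm \<Rightarrow> 'm" where
    \<comment> \<open>\<open>H\<^sup>m(X;A) \<times> H\<^sup>n(X;\<one>) \<rightarrow> H\<^sup>m\<^sup>+\<^sup>n(X;A)\<close>\<close>
  "cup_unit C A m n x y = shm C (m + n) (run C A) \<cdot>\<^bsub>C\<^esub> cup C A (unit_ob C) m n x y"


section \<open>Oriented normal objects\<close>

text \<open>
  \<open>nprj : N \<rightarrow> Z\<close> is the normal object, \<open>dinc : D(N) \<rightarrow> N\<close> its disk bundle, \<open>zsec : Z \<rightarrow> D(N)\<close> the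
  zero section with open complement \<open>dopn : D(N) - Z \<rightarrow> D(N)\<close> and recollement \<open>nrec\<close>,
  \<open>sprj : S(N) \<rightarrow> Z\<close> the sphere bundle, \<open>sinc : S(N) \<rightarrow> D(N) - Z\<close> its inclusion and
  \<open>sret : D(N) - Z \<rightarrow> S(N)\<close> the retraction. The orientation \<open>ornt : \<one>\<^sub>Z \<rightarrow> (s\<^sup>!\<one>)[2r]\<close>, where \<open>s\<close> is the
  zero section, trivialises the orientation object of a normal object of real rank \<open>2r\<close>.\<close>

record ('f, 'o, 'm) normal_obj =
  nprj :: 'f
  dinc :: 'f
  zsec :: 'f
  dopn :: 'f
  sinc :: 'f
  sret :: 'f
  sprj :: 'f
  nrec :: "('o, 'm) recol"
  ornt :: 'm

definition dprj :: "('s, 'f, 'o, 'm) coef_system \<Rightarrow> ('f, 'o, 'm) normal_obj \<Rightarrow> 'f" where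
    \<comment> \<open>the projection \<open>p : D(N) \<rightarrow> Z\<close>\<close>
  "dprj S N = nprj N \<cdot>\<^bsub>Sp S\<^esub> dinc N"

definition oriented_normal_object ::
  "('s, 'f, 'o, 'm) coef_system \<Rightarrow> 's \<Rightarrow> nat \<Rightarrow> ('f, 'o, 'm) normal_obj \<Rightarrow> bool" where
  "oriented_normal_object S Z r N \<longleftrightarrow>
     nprj N \<in> mor (Sp S) (Dom (Sp S) (nprj N)) Z \<and>
     dinc N \<in> mor (Sp S) (Dom (Sp S) (dinc N)) (Dom (Sp S) (nprj N)) \<and>
     zsec N \<in> mor (Sp S) Z (Dom (Sp S) (dinc N)) \<and>
     dopn N \<in> mor (Sp S) (Dom (Sp S) (dopn N)) (Dom (Sp S) (dinc N)) \<and>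
     sinc N \<in> mor (Sp S) (Dom (Sp S) (sprj N)) (Dom (Sp S) (dopn N)) \<and>
     sret N \<in> mor (Sp S) (Dom (Sp S) (dopn N)) (Dom (Sp S) (sprj N)) \<and>
     sprj N \<in> mor (Sp S) (Dom (Sp S) (sprj N)) Z \<and>
     dprj S N \<cdot>\<^bsub>Sp S\<^esub> zsec N = ident (Sp S) Z \<and>
     sret N \<cdot>\<^bsub>Sp S\<^esub> sinc N = ident (Sp S) (Dom (Sp S) (sprj N)) \<and>
     sprj N = dprj S N \<cdot>\<^bsub>Sp S\<^esub> (dopn N \<cdot>\<^bsub>Sp S\<^esub> sinc N) \<and>
     sprj N \<cdot>\<^bsub>Sp S\<^esub> sret N = dprj S N \<cdot>\<^bsub>Sp S\<^esub> dopn N \<and>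
     recollement S (zsec N) (dopn N) (nrec N) \<and>
     ornt N \<in> isos (cc S Z) (unit_ob (cc S Z))
       (sh (cc S Z) (2 * int r) (fo (ups (nrec N)) (unit_ob (tgt S (zsec N)))))"

definition thom_class ::
  "('s, 'f, 'o, 'm) coef_system \<Rightarrow> nat \<Rightarrow> ('f, 'o, 'm) normal_obj \<Rightarrow> 'm" where
    \<comment> \<open>the image of the orientation in \<open>H\<^sub>Z\<^sup>2\<^sup>r(D(N);\<one>)\<close>\<close>
  "thom_class S r N =
     transp S (zsec N) (fo (ups (nrec N)) (unit_ob (tgt S (zsec N)))) (2 * int r) (ornt N)"

definition euler_class ::
  "('s, 'f, 'o, 'm) coef_system \<Rightarrow> nat \<Rightarrow> ('f, 'o, 'm) normal_obj \<Rightarrow> 'm" where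
    \<comment> \<open>the restriction of the Thom class to the zero section, in \<open>H\<^sup>2\<^sup>r(Z;\<one>)\<close>\<close>
  "euler_class S r N =
     shm (src S (zsec N)) (2 * int r) (inv_ar (src S (zsec N)) (pun S (zsec N))) \<cdot>\<^bsub>src S (zsec N)\<^esub>
     res S (zsec N) (unit_ob (tgt S (zsec N))) (2 * int r)
       (forg S (zsec N) (nrec N) (unit_ob (tgt S (zsec N))) (2 * int r) (thom_class S r N))"

definition cup_euler ::
  "('s, 'f, 'o, 'm) coef_system \<Rightarrow> nat \<Rightarrow> ('f, 'o, 'm) normal_obj \<Rightarrow> 'o \<Rightarrow> int \<Rightarrow> 'm \<Rightarrow> 'm" where
    \<comment> \<open>\<open>\<union> e(N) : H\<^sup>m(Z;B) \<rightarrow> H\<^sup>m\<^sup>+\<^sup>2\<^sup>r(Z;B)\<close>\<close>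
  "cup_euler S r N B m x = cup_unit (src S (zsec N)) B m (2 * int r) x (euler_class S r N)"

definition sphere_res ::
  "('s, 'f, 'o, 'm) coef_system \<Rightarrow> ('f, 'o, 'm) normal_obj \<Rightarrow> 'o \<Rightarrow> int \<Rightarrow> 'm \<Rightarrow> 'm" where
    \<comment> \<open>restriction \<open>H\<^sup>k(D(N) - Z; p\<^sup>*B) \<rightarrow> H\<^sup>k(S(N); \<pi>\<^sup>*B)\<close>\<close>
  "sphere_res S N B k x =
     shm (src S (sprj N)) k (inv_ar (src S (sprj N)) (pcmp S (dprj S N) (dopn N \<cdot>\<^bsub>Sp S\<^esub> sinc N) B))
     \<cdot>\<^bsub>src S (sprj N)\<^esub>
     shm (src S (sprj N)) k (inv_ar (src S (sprj N)) (pcmp S (dopn N) (sinc N) (fo (pul S (dprj S N)) B)))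
     \<cdot>\<^bsub>src S (sprj N)\<^esub>
     res S (sinc N) (fo (pul S (dopn N)) (fo (pul S (dprj S N)) B)) k x"


section \<open>The standing hypotheses\<close>

text \<open>Excision: the localisation sequence of \<open>(X, U)\<close> with coefficients \<open>A\<close> is replaced, through
  isomorphisms \<open>exZ\<close>, \<open>exX\<close>, \<open>exU\<close>, by that of \<open>(D(N), D(N) - Z)\<close> with coefficients \<open>p\<^sup>*i\<^sup>*A\<close>; and in
  cohomology \<open>D(N)\<close> retracts onto \<open>Z\<close> and \<open>D(N) - Z\<close> onto \<open>S(N)\<close>. All three of \<open>exZ\<close>, \<open>exX\<close>, \<open>exU\<close> have to
  be isomorphisms: excision for \<open>H\<^sub>Z\<close> alone does not determine the image of \<open>\<delta>\<close>, as for a point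
  in an even sphere.\<close>

definition excision ::
  "('s, 'f, 'o, 'm) coef_system \<Rightarrow> 'f \<Rightarrow> 'f \<Rightarrow> ('o, 'm) recol \<Rightarrow> ('f, 'o, 'm) normal_obj \<Rightarrow> 'o \<Rightarrow>
   (int \<Rightarrow> 'm \<Rightarrow> 'm) \<Rightarrow> (int \<Rightarrow> 'm \<Rightarrow> 'm) \<Rightarrow> (int \<Rightarrow> 'm \<Rightarrow> 'm) \<Rightarrow> bool" where
  "excision S i j R N A exZ exX exU \<longleftrightarrow>
     (let Z = Dom (Sp S) i; X = Cod (Sp S) i; U = Dom (Sp S) j;
          D = Dom (Sp S) (dinc N); DZ = Dom (Sp S) (dopn N); SN = Dom (Sp S) (sprj N);
          B = fo (pul S i) A; A' = fo (pul S (dprj S N)) B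
      in \<forall>k.
        exZ k \<in> iso (coh_supp S i R A k) (coh_supp S (zsec N) (nrec N) A' k) \<and>
        exX k \<in> iso (coh S X A k) (coh S D A' k) \<and>
        exU k \<in> iso (coh S U (fo (pul S j) A) k) (coh S DZ (fo (pul S (dopn N)) A') k) \<and>
        (\<forall>x \<in> carrier (coh_supp S i R A k).
           forg S (zsec N) (nrec N) A' k (exZ k x) = exX k (forg S i R A k x)) \<and>
        (\<forall>x \<in> carrier (coh S X A k). res S (dopn N) A' k (exX k x) = exU k (res S j A k x)) \<and>
        (\<forall>x \<in> carrier (coh S U (fo (pul S j) A) k).
           delta S (dopn N) (nrec N) A' k (exU k x) = exZ (k + 1) (delta S j R A k x)) \<and>
        res S (dprj S N) B k \<in> iso (coh S Z B k) (coh S D A' k) \<and>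
        sphere_res S N B k \<in> iso (coh S DZ (fo (pul S (dopn N)) A') k) (coh S SN (fo (pul S (sprj N)) B) k))"

definition thom_isomorphism ::
  "('s, 'f, 'o, 'm) coef_system \<Rightarrow> 'f \<Rightarrow> ('o, 'm) recol \<Rightarrow> nat \<Rightarrow> 'o \<Rightarrow> (int \<Rightarrow> 'm \<Rightarrow> 'm) \<Rightarrow> bool" where
  "thom_isomorphism S i R r A Th \<longleftrightarrow>
     (\<forall>k. Th k \<in> iso (coh S (Dom (Sp S) i) (fo (pul S i) A) (k - 2 * int r)) (coh_supp S i R A k))"

text \<open>\<open>ptr k : H\<^sup>k\<^sup>-\<^sup>1(S(N); \<pi>\<^sup>*B) \<rightarrow> H\<^sup>k\<^sup>-\<^sup>2\<^sup>r(Z; B)\<close> is \<open>\<pi>\<^sub>*\<close>. In \<^const>\<open>exact_seq\<close> the last group comes first.\<close>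

definition gysin_sequence ::
  "('s, 'f, 'o, 'm) coef_system \<Rightarrow> 's \<Rightarrow> nat \<Rightarrow> ('f, 'o, 'm) normal_obj \<Rightarrow> 'o \<Rightarrow> (int \<Rightarrow> 'm \<Rightarrow> 'm) \<Rightarrow> bool" where
  "gysin_sequence S Z r N B ptr \<longleftrightarrow>
     (let SN = Dom (Sp S) (sprj N); B' = fo (pul S (sprj N)) B
      in \<forall>k. exact_seq
        ([coh S SN B' k, coh S Z B k, coh S Z B (k - 2 * int r), coh S SN B' (k - 1), coh S Z B (k - 1)],
         [res S (sprj N) B k, cup_euler S r N B (k - 2 * int r), ptr k, res S (sprj N) B (k - 1)]))"

definition localisation_is_gysin ::
  "('s, 'f, 'o, 'm) coef_system \<Rightarrow> 'f \<Rightarrow> nat \<Rightarrow> ('f, 'o, 'm) normal_obj \<Rightarrow> 'o \<Rightarrow>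
   (int \<Rightarrow> 'm \<Rightarrow> 'm) \<Rightarrow> (int \<Rightarrow> 'm \<Rightarrow> 'm) \<Rightarrow> (int \<Rightarrow> 'm \<Rightarrow> 'm) \<Rightarrow> bool" where
  "localisation_is_gysin S i r N A exZ Th ptr \<longleftrightarrow>
     (let Z = Dom (Sp S) i; DZ = Dom (Sp S) (dopn N);
          B = fo (pul S i) A; A' = fo (pul S (dprj S N)) B
      in \<forall>k.
        (\<forall>x \<in> carrier (coh S Z B (k - 2 * int r)).
           forg S (zsec N) (nrec N) A' k (exZ k (Th k x))
             = res S (dprj S N) B k (cup_euler S r N B (k - 2 * int r) x)) \<and>
        (\<forall>x \<in> carrier (coh S Z B k).
           sphere_res S N B k (res S (dopn N) A' k (res S (dprj S N) B k x)) = res S (sprj N) B k x) \<and>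
        (\<forall>y \<in> carrier (coh S DZ (fo (pul S (dopn N)) A') (k - 1)).
           exZ k (Th k (ptr k (sphere_res S N B (k - 1) y))) = delta S (dopn N) (nrec N) A' (k - 1) y))"


section \<open>Subgroups in the main statement\<close>

definition image_gysin_boundary ::
  "('s, 'f, 'o, 'm) coef_system \<Rightarrow> ('f, 'o, 'm) normal_obj \<Rightarrow> 'o \<Rightarrow> (int \<Rightarrow> 'm \<Rightarrow> 'm) \<Rightarrow> int \<Rightarrow> 'm set" where
  "image_gysin_boundary S N B ptr d =
     ptr d ` carrier (coh S (Dom (Sp S) (sprj N)) (fo (pul S (sprj N)) B) (d - 1))"

definition kernel_cup_euler ::
  "('s, 'f, 'o, 'm) coef_system \<Rightarrow> 's \<Rightarrow> nat \<Rightarrow> ('f, 'o, 'm) normal_obj \<Rightarrow> 'o \<Rightarrow> int \<Rightarrow> 'm set" where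
  "kernel_cup_euler S Z r N B d =
     kernel (coh S Z B (d - 2 * int r)) (coh S Z B d) (cup_euler S r N B (d - 2 * int r))"

end

theory Submission
  imports Defs
begin

text \<open>Excision and the comparison of the localisation sequence with the Gysin sequence give
  \<open>\<delta> = Th \<circ> \<pi>\<^sub>* \<circ> \<phi>\<close>, where \<open>\<phi>\<close> is an isomorphism from \<open>H\<^sup>d\<^sup>-\<^sup>1(U; j\<^sup>*A)\<close> to the cohomology of the sphere
  bundle. So \<open>Th\<close> maps the image of \<open>\<pi>\<^sub>*\<close> onto that of \<open>\<delta>\<close>, and by the exactness of the Gysin sequence the
  image of \<open>\<pi>\<^sub>*\<close> is the kernel of \<open>\<union> e(N)\<close>.\<close>

text \<open>\<open>inv_ar\<close> is a definite description, so it can be typed only once two-sided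
  inverses are known to be unique. It is applied to the unit comparison \<open>pun\<close> inside
  \<open>transp\<close>.\<close>

lemma (in category) inv_ar_mor:
  assumes f: "f \<in> isos C a b"
  shows "inv_ar C f \<in> mor C b a"
proof -
  have fm: "f \<in> mor C a b" and ends: "Dom C f = a" "Cod C f = b"
    using f by (auto simp: isos_def mor_def)
  obtain g where g: "g \<in> mor C b a" "g \<cdot> f = ident C a" "f \<cdot> g = ident C b"
    using f by (auto simp: isos_def)
  have "inv_ar C f = g"
    unfolding inv_ar_def ends
  proof (rule the_equality)
    fix h assume h: "h \<in> mor C b a \<and> h \<cdot> f = ident C a \<and> f \<cdot> h = ident C b"
    then have "h = h \<cdot> (f \<cdot> g)"
      using g cmp_ident_right by metis
    also have "\<dots> = (h \<cdot> f) \<cdot> g"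
      using cmp_assoc[OF g(1) fm, of h a] h by simp
    also have "\<dots> = g"
      using h g cmp_ident_left by metis
    finally show "h = g" .
  qed (use g in simp)
  with g show ?thesis by simp
qed

context coefficient_system
begin

lemma eta_mor:
  assumes f: "f \<in> Ar (Sp S)" and a: "a \<in> Ob (tgt S f)"
  shows "eta S f a \<in> mor (tgt S f) a (fo (psh S f) (fo (pul S f) a))"
  using pul_psh[OF f] a
  by (auto simp: exact_adjunction_def exact_nat_trans_def nat_trans_def id_xftor_def comp_xftor_def)

lemma transp_mor:
  assumes f: "f \<in> Ar (Sp S)" and B: "B \<in> Ob (src S f)" and x: "x \<in> carrier (coh S (Dom (Sp S) f) B k)"
  shows "transp S f B k x \<in> carrier (coh S (Cod (Sp S) f) (fo (psh S f) B) k)"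
proof -
  interpret Sp: category "Sp S" by (rule spaces)
  interpret Y: tt_category "src S f" using coefficients Sp.dom_ob f by blast
  interpret X: tt_category "tgt S f" using coefficients Sp.cod_ob f by blast
  have psh: "exact_functor (src S f) (tgt S f) (psh S f)"
    using pul_psh[OF f] by (simp add: exact_adjunction_def)
  \<comment> \<open>The adjunction takes maps out of the pullback of the unit, whereas a cohomology
    class starts at the unit itself; the inverse of \<open>pun\<close> bridges the two.\<close>
  have "inv_ar (src S f) (pun S f) \<in> mor (src S f) (fo (pul S f) (unit_ob (tgt S f))) (unit_ob (src S f))"
    using pul_monoidal[OF f] by (intro Y.inv_ar_mor) (simp add: symmetric_monoidal_def)
  moreover have "x \<in> mor (src S f) (unit_ob (src S f)) (sh (src S f) k B)"
    using x by (simp add: coh_def Hom_group_def)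
  ultimately have "x \<cdot>\<^bsub>src S f\<^esub> inv_ar (src S f) (pun S f)
      \<in> mor (src S f) (fo (pul S f) (unit_ob (tgt S f))) (sh (src S f) k B)"
    by (rule Y.cmp_mor)
  then have "fm (psh S f) (x \<cdot>\<^bsub>src S f\<^esub> inv_ar (src S f) (pun S f))
      \<in> mor (tgt S f) (fo (psh S f) (fo (pul S f) (unit_ob (tgt S f)))) (fo (psh S f) (sh (src S f) k B))"
    using psh by (simp add: exact_functor_def additive_functor_def is_functor_def)
  moreover have "fsh (psh S f) k B \<in> mor (tgt S f) (fo (psh S f) (sh (src S f) k B)) (sh (tgt S f) k (fo (psh S f) B))"
    using psh B by (simp add: exact_functor_def isos_def)
  ultimately show ?thesis
    using eta_mor[OF f X.unit_ob] X.cmp_mor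
    by (simp add: transp_def coh_def Hom_group_def) blast
qed

text \<open>The hypotheses describe \<open>delta\<close> only after \<open>exZ\<close>, which is
  injective on the carrier of supported cohomology. Cancelling \<open>exZ\<close> therefore requires
  that \<open>delta\<close> lands in this carrier.\<close>

lemma delta_mor:
  assumes R: "recollement S i j R" and A: "A \<in> Ob (tgt S j)"
    and x: "x \<in> carrier (coh S (Dom (Sp S) j) (fo (pul S j) A) k)"
  shows "delta S j R A k x \<in> carrier (coh_supp S i R A (k + 1))"
proof -
  have i: "i \<in> Ar (Sp S)" and j: "j \<in> Ar (Sp S)" and cod: "Cod (Sp S) i = Cod (Sp S) j"
    using R by (simp_all add: recollement_def)
  interpret Sp: category "Sp S" by (rule spaces)
  interpret X: tt_category "tgt S j" using coefficients Sp.cod_ob j by blast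
  have jA: "fo (pul S j) A \<in> Ob (src S j)"
    using pul_psh[OF j] A
    by (simp add: exact_adjunction_def exact_functor_def additive_functor_def is_functor_def)
  have supp: "supp_obj S i R A \<in> Ob (tgt S j)"
    using R pul_psh[OF i] A cod
    by (simp add: recollement_def exact_adjunction_def exact_functor_def additive_functor_def is_functor_def)
  have "bdr R A \<in> mor (tgt S j) (fo (psh S j) (fo (pul S j) A)) (sh (tgt S j) 1 (supp_obj S i R A))"
    using R A cod by (simp add: recollement_def nat_trans_def comp_xftor_def shifted_def)
  then have "shm (tgt S j) k (bdr R A)
      \<in> mor (tgt S j) (sh (tgt S j) k (fo (psh S j) (fo (pul S j) A)))
          (sh (tgt S j) k (sh (tgt S j) 1 (supp_obj S i R A)))"
    using X.shift_additive[of k] by (simp add: additive_functor_def is_functor_def shift_ftor_def)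
  \<comment> \<open>The shift is strict: shifting by \<open>1\<close> and then by \<open>k\<close>
    equals shifting by \<open>k + 1\<close> as objects, so no comparison arrow enters.\<close>
  with transp_mor[OF j jA x] show ?thesis
    using X.cmp_mor X.shift_add(1)[OF supp, of k 1] cod
    by (simp add: delta_def coh_supp_def coh_def Hom_group_def)
qed

end

theorem proposition4p7:
  fixes S :: "('s, 'f, 'o, 'm) coef_system"
    and X Z U :: 's and i j :: 'f and R :: "('o, 'm) recol"
    and r :: nat and N :: "('f, 'o, 'm) normal_obj"
    and A :: 'o and d :: int and c :: 'm
    and exZ exX exU Th ptr :: "int \<Rightarrow> 'm \<Rightarrow> 'm"
  assumes "coefficient_system S"
    and "i \<in> mor (Sp S) Z X" and "j \<in> mor (Sp S) U X"
    and "recollement S i j R"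
    and "oriented_normal_object S Z r N"
    and "A \<in> Ob (cc S X)"
    and "excision S i j R N A exZ exX exU"
    and "thom_isomorphism S i R r A Th"
    and "gysin_sequence S Z r N (fo (pul S i) A) ptr"
    and "localisation_is_gysin S i r N A exZ Th ptr"
    and "c \<in> carrier (coh S X A d)"
    and "res S j A d c = one (coh S U (fo (pul S j) A) d)"
  shows "let B = fo (pul S i) A;
             H = coh S Z B (d - 2 * int r);
             HZ = coh_supp S i R A d;
             G = secondary_boundary_group S i j R A d c;
             K = kernel_cup_euler S Z r N B d
         in Th d ` image_gysin_boundary S N B ptr d = G \<and>
            Th d \<in> iso (H\<lparr>carrier := K\<rparr>) (HZ\<lparr>carrier := G\<rparr>) \<and>
            HZ\<lparr>carrier := G\<rparr> \<cong> H\<lparr>carrier := K\<rparr>"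
proof -
  interpret coefficient_system S by fact
  define B where "B = fo (pul S i) A"
  define A' where "A' = fo (pul S (dprj S N)) B"
  let ?HU = "coh S U (fo (pul S j) A) (d - 1)"
  let ?HDZ = "coh S (Dom (Sp S) (dopn N)) (fo (pul S (dopn N)) A') (d - 1)"
  let ?HS = "coh S (Dom (Sp S) (sprj N)) (fo (pul S (sprj N)) B) (d - 1)"
  let ?H = "coh S Z B (d - 2 * int r)"
  let ?HZ = "coh_supp S i R A d"
  let ?I = "image_gysin_boundary S N B ptr d"
  let ?K = "kernel_cup_euler S Z r N B d"
  let ?G = "secondary_boundary_group S i j R A d c"
  let ?\<phi> = "\<lambda>x. sphere_res S N B (d - 1) (exU (d - 1) x)"
  have ends: "Dom (Sp S) i = Z" "Dom (Sp S) j = U" "Cod (Sp S) j = X"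
    using assms(2,3) by (auto simp: mor_def)

  have Th: "Th d \<in> iso ?H ?HZ"
    using assms(8) by (simp add: thom_isomorphism_def ends B_def)
  have exZ: "inj_on (exZ d) (carrier ?HZ)"
    and exU: "bij_betw (exU (d - 1)) (carrier ?HU) (carrier ?HDZ)"
    and sph: "bij_betw (sphere_res S N B (d - 1)) (carrier ?HDZ) (carrier ?HS)"
    using assms(7) by (simp_all add: excision_def Let_def iso_def ends B_def A'_def bij_betw_def)
  have exZ_delta: "delta S (dopn N) (nrec N) A' (d - 1) (exU (d - 1) x) = exZ d (delta S j R A (d - 1) x)"
    if "x \<in> carrier ?HU" for x
  proof -
    \<comment> \<open>Excision is indexed by the degree before the boundary, so \<open>k\<close> is
      \<open>d - 1\<close> and \<open>exZ (k + 1)\<close> becomes \<open>exZ d\<close>.\<close>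
    have "\<forall>k. \<forall>x \<in> carrier (coh S U (fo (pul S j) A) k).
        delta S (dopn N) (nrec N) A' k (exU k x) = exZ (k + 1) (delta S j R A k x)"
      using assms(7) by (simp add: excision_def Let_def ends B_def A'_def)
    from this[rule_format, of x "d - 1"] that show ?thesis by simp
  qed
  have Th_ptr: "exZ d (Th d (ptr d (sphere_res S N B (d - 1) y))) = delta S (dopn N) (nrec N) A' (d - 1) y"
    if "y \<in> carrier ?HDZ" for y
    using assms(10) that by (simp add: localisation_is_gysin_def Let_def B_def A'_def)
  have "exact_seq
        ([coh S (Dom (Sp S) (sprj N)) (fo (pul S (sprj N)) B) d, coh S Z B d, ?H, ?HS, coh S Z B (d - 1)],
         [res S (sprj N) B d, cup_euler S r N B (d - 2 * int r), ptr d, res S (sprj N) B (d - 1)])"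
    using assms(9) by (simp only: gysin_sequence_def Let_def B_def)
  \<comment> \<open>Exactness at the source of the cup product gives kernel equal to image.
    \<open>exact_seq\<close> also contains the group axioms and homomorphism properties, which is
    where the group structure of \<open>?H\<close> comes from.\<close>
  then have gysin: "ptr d \<in> hom ?HS ?H" "?K = ?I" "group_hom ?H (coh S Z B d) (cup_euler S r N B (d - 2 * int r))"
    by (auto simp: kernel_cup_euler_def image_gysin_boundary_def group_hom_def group_hom_axioms_def)

  have \<phi>: "bij_betw ?\<phi> (carrier ?HU) (carrier ?HS)"
    using bij_betw_trans[OF exU sph] by (simp add: comp_def)
  \<comment> \<open>Both sides agree after \<open>exZ d\<close>: each becomes the boundary of
    \<open>exU (d - 1) x\<close> in the disk-bundle pair.\<close>
  have delta: "delta S j R A (d - 1) x = Th d (ptr d (?\<phi> x))" if x: "x \<in> carrier ?HU" for x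
  proof (rule inj_onD[OF exZ])
    show "exZ d (delta S j R A (d - 1) x) = exZ d (Th d (ptr d (?\<phi> x)))"
      using exZ_delta[OF x] Th_ptr bij_betwE[OF exU] x by simp
    show "delta S j R A (d - 1) x \<in> carrier ?HZ"
      using delta_mor[OF assms(4), of A x "d - 1"] assms(6) x by (simp add: ends)
    show "Th d (ptr d (?\<phi> x)) \<in> carrier ?HZ"
      using bij_betwE[OF \<phi>] x gysin(1) Th by (auto simp: iso_def hom_def Pi_iff)
  qed
  have G: "Th d ` ?I = ?G"
  proof -
    have "?G = (\<lambda>x. Th d (ptr d (?\<phi> x))) ` carrier ?HU"
      using delta by (simp add: secondary_boundary_group_def ends)
    also have "\<dots> = Th d ` ptr d ` ?\<phi> ` carrier ?HU"
      by (simp add: image_image)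
    \<comment> \<open>Surjectivity of \<open>?\<phi>\<close> makes the image run over all classes on
      the sphere bundle.\<close>
    also have "\<dots> = Th d ` ?I"
      using \<phi> by (simp add: bij_betw_def image_gysin_boundary_def)
    finally show ?thesis by simp
  qed
  interpret cup: group_hom ?H "coh S Z B d" "cup_euler S r N B (d - 2 * int r)"
    by (rule gysin(3))
  have K: "subgroup ?K ?H"
    unfolding kernel_cup_euler_def by (rule cup.subgroup_kernel)
  \<comment> \<open>Changing the carrier leaves the operations alone, so \<open>Th d\<close>
    restricts; it is onto \<open>?G\<close> by \<open>G\<close>, since \<open>?K\<close> equals
    \<open>?I\<close>.\<close>
  have iso: "Th d \<in> iso (?H\<lparr>carrier := ?K\<rparr>) (?HZ\<lparr>carrier := ?G\<rparr>)"
    using Th subgroup.subset[OF K] G gysin(2)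
    by (auto simp: iso_def hom_def bij_betw_def subset_iff intro: inj_on_subset)
  have "group (?H\<lparr>carrier := ?K\<rparr>)"
    using K cup.G.subgroup_imp_group by blast
  \<comment> \<open>The inverse of the restricted \<open>Th d\<close> is the witness; inverting uses
    the group structure on the kernel side, the source of \<open>Th d\<close>.\<close>
  then have "?HZ\<lparr>carrier := ?G\<rparr> \<cong> ?H\<lparr>carrier := ?K\<rparr>"
    using group.iso_set_sym[OF _ iso] by (auto simp: is_iso_def)
  with G iso show ?thesis
    unfolding Let_def B_def by simp
qed

end
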